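(* Let $\vec n\in\mathbb N_0^p$, $\vec m\in\mathbb N_0^q$ with $|\vec m|=|\vec n|+1$. Up to a nonzero constant common to all components, the components of the type-II mixed Piñeiro form are, for every $j\in\{1,\ldots,q\}$ with $m_j\ge1$, $$B^{(j)}_{\vec n,\vec m}(x)=\frac{\prod_{i=1}^p(\alpha_i+\beta_j+1)_{n_i}}{(m_j-1)!\prod_{i=1,i\ne j}^q(\beta_i-\beta_j)_{m_i}}\;{}_{p+q}F_{p+q-1}\!\left[\begin{matrix}-m_j+1,\ \{\alpha_k+\beta_j+n_k+1\}_{k=1}^p,\ \{\beta_j-\beta_k-m_k+1\}_{k=1,k\ne j}^q\\ \{\alpha_k+\beta_j+1\}_{k=1}^p,\ \{\beta_j-\beta_k+1\}_{k=1,k\ne j}^q\end{matrix};x\right].$$ The coefficient of $x^k$ in $B^{(j)}_{\vec n,\vec m}$, $0\le k\le m_j-1$, is $$B^{(j)}_{\vec n,\vec m}[k]=\frac{\prod_{i=1}^p(\alpha_i+k+\beta_j+1)_{n_i}}{\prod_{i=1,i\ne j}^q(\beta_i-\beta_j-k)_{m_i}\;k!\,(m_j-k-1)!\,(-1)^k},$$ and the leading coefficient is $$B^{(j)}_{\vec n,\vec m}[m_j-1]=\frac{\prod_{i=1}^p(\beta_j+m_j+\alpha_i)_{n_i}}{\prod_{i=1,i\ne j}^q(\beta_i-\beta_j-m_j+1)_{m_i}\,(m_j-1)!\,(-1)^{m_j-1}}.$$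
   Context: $p,q\ge1$; real parameters satisfy $\alpha_i>-1$, $\beta_j>-1$, $\alpha_i+\beta_j>-1$ for all $1\le i\le p$, $1\le j\le q$; $\alpha_i-\alpha_h\notin\mathbb Z$ for $i\ne h$ and $\beta_j-\beta_s\notin\mathbb Z$ for $j\neq s$. $(z)_0=1$, $(z)_n=\prod_{r=0}^{n-1}(z+r)$; $|\cdot|$ is the sum of components of a multi-index. ${}_aF_b\left[\begin{smallmatrix}a_1,\ldots,a_a\\ c_1,\ldots,c_b\end{smallmatrix};x\right]=\sum_{l\ge0}\frac{(a_1)_l\cdots(a_a)_l}{(c_1)_l\cdots(c_b)_l}\frac{x^l}{l!}$ (terminating here). For $|\vec m|=|\vec n|+1$, the type-II mixed Piñeiro form is the nonzero function $B_{\vec n,\vec m}(x)=\sum_{j=1}^qB^{(j)}_{\vec n,\vec m}(x)x^{\beta_j}$ with polynomials $\deg B^{(j)}_{\vec n,\vec m}\le m_j-1$ ($B^{(j)}\equiv0$ if $m_j=0$) such that $\int_0^1B_{\vec n,\vec m}(x)x^{k+\alpha_i}\,\mathrm dx=0$ for $0\le k\le n_i-1$, $1\le i\le p$; it is unique up to a nonzero constant factor (known perfectness of the system). The common constant for which the formulas hold exactly is that of the contour normalization $B_{\vec n,\vec m}(x)=\int_\Sigma\frac{x^t\prod_{i}(t+\alpha_i+1)_{n_i}}{\prod_{j}(\beta_j-t)_{m_j}}\frac{\mathrm dt}{2\pi\mathrm i}$, with $\Sigma$ clockwise enclosing once exactly the poles $\beta_j+k$, $0\le k\le m_j-1$, $1\le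 j\le q$. *)

theory Defs
  imports "HOL-Complex_Analysis.Complex_Analysis"
begin

text \<open>Multi-indices and parameter vectors are functions on \<^typ>\<open>nat\<close> of which only the values
  on \<open>{1..p}\<close> (for \<open>\<alpha>\<close>, \<open>n\<close>) and \<open>{1..q}\<close> (for \<open>\<beta>\<close>, \<open>m\<close>, \<open>B\<close>) are used.\<close>

definition hypergeom :: "real list \<Rightarrow> real list \<Rightarrow> real \<Rightarrow> real" where
  "hypergeom as bs x = eval_fps (fps_hypergeo as bs 1) x"

lemma hypergeom_series:
  "hypergeom as bs x =
    (\<Sum>l. (\<Prod>a\<leftarrow>as. pochhammer a l) / (\<Prod>b\<leftarrow>bs. pochhammer b l) * (x ^ l / fact l))"
proof -
  have "foldl (\<lambda>r a. r * pochhammer a l) v cs = v * (\<Prod>a\<leftarrow>cs. pochhammer a l)"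
    for l v and cs :: "real list"
    by (induction cs arbitrary: v) (auto simp: mult.assoc)
  then show ?thesis
    by (simp add: hypergeom_def eval_fps_def)
qed

text \<open>Only used for \<open>x > 0\<close>; at \<open>x = 0\<close>, \<open>powr\<close> takes the junk value \<open>0\<close>.\<close>

definition mixed_form :: "nat \<Rightarrow> (nat \<Rightarrow> real) \<Rightarrow> (nat \<Rightarrow> real poly) \<Rightarrow> real \<Rightarrow> real" where
  "mixed_form q \<beta> B x = (\<Sum>j=1..q. poly (B j) x * x powr \<beta> j)"

definition typeII_pineiro ::
  "nat \<Rightarrow> nat \<Rightarrow> (nat \<Rightarrow> real) \<Rightarrow> (nat \<Rightarrow> real) \<Rightarrow> (nat \<Rightarrow> nat) \<Rightarrow> (nat \<Rightarrow> nat) \<Rightarrow>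
    (nat \<Rightarrow> real poly) \<Rightarrow> bool" where
  "typeII_pineiro p q \<alpha> \<beta> n m B \<longleftrightarrow>
    (\<forall>j\<in>{1..q}. if m j = 0 then B j = 0 else degree (B j) \<le> m j - 1) \<and>
    (\<exists>x\<in>{0<..<1}. mixed_form q \<beta> B x \<noteq> 0) \<and>
    (\<forall>i\<in>{1..p}. \<forall>k<n i.
      ((\<lambda>x. mixed_form q \<beta> B x * x powr (real k + \<alpha> i)) has_integral 0) {0..1})"

text \<open>Closed contours with winding number \<open>-1\<close> (clockwise, once) about every point
  \<open>\<beta>\<^sub>j + k\<close>, \<open>0 \<le> k < m\<^sub>j\<close>. These are the only singularities of the integrand below, so nothing
  has to be required about other points.\<close>

definition pineiro_contour ::
  "nat \<Rightarrow> (nat \<Rightarrow> real) \<Rightarrow> (nat \<Rightarrow> nat) \<Rightarrow> (real \<Rightarrow> complex) \<Rightarrow> bool" where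
  "pineiro_contour q \<beta> m \<gamma> \<longleftrightarrow>
    valid_path \<gamma> \<and> pathfinish \<gamma> = pathstart \<gamma> \<and>
    (\<forall>j\<in>{1..q}. \<forall>k<m j.
      of_real (\<beta> j + real k) \<notin> path_image \<gamma> \<and>
      winding_number \<gamma> (of_real (\<beta> j + real k)) = -1)"

definition contour_form ::
  "nat \<Rightarrow> nat \<Rightarrow> (nat \<Rightarrow> real) \<Rightarrow> (nat \<Rightarrow> real) \<Rightarrow> (nat \<Rightarrow> nat) \<Rightarrow> (nat \<Rightarrow> nat) \<Rightarrow>
    (real \<Rightarrow> complex) \<Rightarrow> real \<Rightarrow> complex" where
  "contour_form p q \<alpha> \<beta> n m \<gamma> x =
    contour_integral \<gamma>
      (\<lambda>t. of_real x powr t * (\<Prod>i=1..p. pochhammer (t + of_real (\<alpha> i) + 1) (n i)) /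
            (\<Prod>j=1..q. pochhammer (of_real (\<beta> j) - t) (m j)))
    / (2 * of_real pi * \<i>)"

lemma pineiro_contour_exists: "\<exists>\<gamma>. pineiro_contour q \<beta> m \<gamma> \<and> simple_path \<gamma>"
proof -
  define P where "P = (\<Union>j\<in>{1..q}. (\<lambda>k. complex_of_real (\<beta> j + real k)) ` {..<m j})"
  have "finite P" by (auto simp: P_def)
  then have "bounded P" by (rule finite_imp_bounded)
  then obtain r where r: "r > 0" "P \<subseteq> ball 0 r"
    using bounded_subset_ballD by blast
  define \<gamma> where "\<gamma> = reversepath (circlepath 0 r)"
  have img: "path_image \<gamma> = sphere 0 r"
    using r by (simp add: \<gamma>_def)
  have "w \<notin> path_image \<gamma> \<and> winding_number \<gamma> w = -1" if "w \<in> P" for w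
  proof -
    have w: "norm (w - 0) < r" using that r by auto
    have "w \<notin> path_image (circlepath 0 r)" using w r by auto
    then have "winding_number \<gamma> w = - winding_number (circlepath 0 r) w"
      unfolding \<gamma>_def by (intro winding_number_reversepath) auto
    then show ?thesis using w img winding_number_circlepath[OF w] by auto
  qed
  moreover have "of_real (\<beta> j + real k) \<in> P" if "j \<in> {1..q}" "k < m j" for j k
    using that unfolding P_def by blast
  ultimately have "pineiro_contour q \<beta> m \<gamma>"
    unfolding pineiro_contour_def by (auto simp: \<gamma>_def)
  moreover have "simple_path \<gamma>"
    using r by (simp add: \<gamma>_def simple_path_reversepath simple_path_circlepath)
  ultimately show ?thesis by blast
qed

end

theory Submission
  imports Defs
begin

text \<open>The form is a combination \<open>\<Sum> c\<^sub>s x\<^bsup>b\<^sub>s\<^esup>\<close> of powers with the \<open>|m|\<close> distinct exponents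
  \<open>b\<^sub>s = \<beta>\<^sub>j + k\<close>, and \<open>\<integral>\<^sub>0\<^sup>1 x\<^bsup>b + a\<^esup> dx = 1 / (b - t)\<close> for \<open>t = -(a + 1)\<close>. Orthogonality
  thus says that the rational function \<open>\<Sum> c\<^sub>s / (b\<^sub>s - t)\<close> vanishes at the \<open>|n| = |m| - 1\<close> points
  \<open>t = -(\<alpha>\<^sub>i + k + 1)\<close>. Its numerator has degree at most \<open>|n|\<close>, so it is a multiple of
  \<open>\<Prod>\<^sub>i (t + \<alpha>\<^sub>i + 1)\<^bsub>n\<^sub>i\<^esub>\<close>, and evaluation at \<open>b\<^sub>s\<close> gives \<open>c\<^sub>s\<close>. The same partial
  fraction expansion turns the contour integral into Cauchy's formula for \<open>x\<^sup>t\<close> at each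
  \<open>b\<^sub>s\<close>, and applied at \<open>t = -1, -2, \<dots>\<close> it shows that the powers are linearly independent on
  \<open>(0, 1)\<close>.\<close>

section \<open>Sums of simple fractions and their numerators\<close>

text \<open>The numerator of \<open>\<Sum> c s / (b s - t)\<close> over the common denominator \<open>\<Prod> (b s - t)\<close>.\<close>

definition cauchy_num :: "'s set \<Rightarrow> ('s \<Rightarrow> 'a::field) \<Rightarrow> ('s \<Rightarrow> 'a) \<Rightarrow> 'a poly" where
  "cauchy_num S b c = (\<Sum>s\<in>S. smult (c s) (\<Prod>r\<in>S - {s}. [:b r, -1:]))"

lemma poly_cauchy_num:
  assumes "finite S" "t \<notin> b ` S"
  shows "poly (cauchy_num S b c) t = (\<Sum>s\<in>S. c s / (b s - t)) * (\<Prod>s\<in>S. b s - t)"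
proof -
  have "c s * (\<Prod>r\<in>S - {s}. b r - t) = c s / (b s - t) * (\<Prod>s\<in>S. b s - t)" if "s \<in> S" for s
    using assms that by (auto simp: prod.remove[of S s])
  then show ?thesis
    by (simp add: cauchy_num_def poly_sum poly_prod sum_distrib_right)
qed

text \<open>Every summand belonging to some r other than \<open>s\<close> contains the factor
  \<open>b s - b s\<close>, so one term survives. This recovers the coefficients from the
  numerator.\<close>

lemma poly_cauchy_num_node:
  assumes "finite S" "s \<in> S"
  shows "poly (cauchy_num S b c) (b s) = c s * (\<Prod>r\<in>S - {s}. b r - b s)"
proof -
  have "c r * (\<Prod>u\<in>S - {r}. b u - b s) = 0" if "r \<in> S - {s}" for r
    using assms that by (auto intro!: prod_zero)
  then have "(\<Sum>r\<in>S - {s}. c r * (\<Prod>u\<in>S - {r}. b u - b s)) = 0"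
    by (rule sum.neutral[rule_format])
  then show ?thesis
    using assms by (simp add: cauchy_num_def poly_sum poly_prod sum.remove[of S s])
qed

lemma degree_cauchy_num:
  assumes "finite S" "S \<noteq> {}"
  shows "degree (cauchy_num S b c) < card S"
proof -
  have "degree (smult (c s) (\<Prod>r\<in>S - {s}. [:b r, -1:])) \<le> card S - 1" if "s \<in> S" for s
  proof -
    have "degree (\<Prod>r\<in>S - {s}. [:b r, -1:]) = card S - 1"
      using assms that by (subst degree_prod_sum_eq) auto
    then show ?thesis
      by (metis degree_smult_le)
  qed
  then have "degree (cauchy_num S b c) \<le> card S - 1"
    using assms unfolding cauchy_num_def by (intro degree_sum_le) auto
  then show ?thesis
    using assms by (metis Suc_pred' card_gt_0_iff less_Suc_eq_le)
qed

lemma prod_node_diff_nonzero: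
  fixes b :: "'s \<Rightarrow> 'a::field"
  assumes "finite S" "inj_on b S" "s \<in> S"
  shows "(\<Prod>r\<in>S - {s}. b r - b s) \<noteq> 0"
  using assms by (auto dest: inj_onD)

text \<open>Lagrange interpolation: \<open>P\<close> and the numerator built from the proposed
  coefficients have degree below \<open>card S\<close> and agree at the \<open>card S\<close>
  distinct nodes.\<close>

lemma partial_fractions:
  fixes b :: "'s \<Rightarrow> 'a::field"
  assumes S: "finite S" "inj_on b S" and deg: "degree P < card S" and t: "t \<notin> b ` S"
  shows "poly P t / (\<Prod>s\<in>S. b s - t) =
    (\<Sum>s\<in>S. poly P (b s) / (\<Prod>r\<in>S - {s}. b r - b s) / (b s - t))"
proof -
  define c where "c s = poly P (b s) / (\<Prod>r\<in>S - {s}. b r - b s)" for s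
  have "S \<noteq> {}"
    using deg by auto
  have "cauchy_num S b c = P"
  proof (rule poly_eqI_degree[where A = "b ` S"])
    show "poly (cauchy_num S b c) x = poly P x" if "x \<in> b ` S" for x
      using that S prod_node_diff_nonzero[OF S]
      by (auto simp: poly_cauchy_num_node c_def)
  qed (use S deg degree_cauchy_num[OF S(1) \<open>S \<noteq> {}\<close>] in \<open>auto simp: card_image\<close>)
  then have "poly P t = (\<Sum>s\<in>S. c s / (b s - t)) * (\<Prod>s\<in>S. b s - t)"
    using poly_cauchy_num[OF S(1) t, of c] by simp
  moreover have "(\<Prod>s\<in>S. b s - t) \<noteq> 0"
    using S t by auto
  ultimately show ?thesis
    by (simp add: c_def)
qed

text \<open>The numerator has degree below \<open>card S\<close> but at least \<open>card S\<close>
  zeros, so it is 0; its values at the nodes are the coefficients times nonzero products.\<close>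

lemma cauchy_sum_zeros_trivial:
  fixes b :: "'s \<Rightarrow> 'a::field"
  assumes S: "finite S" "inj_on b S" and T: "T \<inter> b ` S = {}" "card S \<le> card T"
    and zero: "\<And>t. t \<in> T \<Longrightarrow> (\<Sum>s\<in>S. c s / (b s - t)) = 0"
    and s: "s \<in> S"
  shows "c s = 0"
proof -
  have ne: "S \<noteq> {}" using s by auto
  have "cauchy_num S b c = 0"
  proof (rule poly_eqI_degree[where A = T])
    show "poly (cauchy_num S b c) t = poly 0 t" if "t \<in> T" for t
      using that T S zero by (subst poly_cauchy_num) auto
  qed (use T degree_cauchy_num[OF S(1) ne, of b c] in auto)
  then show ?thesis
    using poly_cauchy_num_node[OF S(1) s, of b c] prod_node_diff_nonzero[OF S s] by simp
qed

text \<open>With one zero fewer than poles the numerator has degree at most \<open>card T\<close>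
  and vanishes on \<open>T\<close>, which leaves only multiples of the monic polynomial with zero
  set \<open>T\<close>.\<close>

lemma cauchy_sum_zeros_unique:
  fixes b :: "'s \<Rightarrow> 'a::field"
  assumes S: "finite S" "inj_on b S" and T: "finite T" "T \<inter> b ` S = {}" "card S = card T + 1"
    and zero: "\<And>t. t \<in> T \<Longrightarrow> (\<Sum>s\<in>S. c s / (b s - t)) = 0"
  shows "\<exists>k. \<forall>s\<in>S. c s = k * ((\<Prod>t\<in>T. b s - t) / (\<Prod>r\<in>S - {s}. b r - b s))"
proof -
  define P where "P = (\<Prod>t\<in>T. [:-t, 1:])"
  have P: "poly P x = (\<Prod>t\<in>T. x - t)" for x
    by (simp add: P_def poly_prod)
  have dP: "degree P = card T"
    unfolding P_def by (subst degree_prod_sum_eq) auto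
  obtain s0 where s0: "s0 \<in> S"
    using T(3) by fastforce
  then have ne: "S \<noteq> {}" by auto
  have P0: "poly P (b s0) \<noteq> 0"
    using T s0 unfolding P by auto
  \<comment> \<open>This factor makes both polynomials agree at \<open>b s0\<close>, the extra point
    outside \<open>T\<close> that degree \<open>card T\<close> requires.\<close>
  define k where "k = poly (cauchy_num S b c) (b s0) / poly P (b s0)"
  have "cauchy_num S b c = smult k P"
  proof (rule poly_eqI_degree[where A = "insert (b s0) T"])
    show "poly (cauchy_num S b c) x = poly (smult k P) x" if "x \<in> insert (b s0) T" for x
    proof (cases "x = b s0")
      case True
      then show ?thesis using P0 by (simp add: k_def)
    next
      case False
      then have "x \<in> T" using that by simp
      then have "x \<notin> b ` S" "poly P x = 0"
        using T unfolding P by auto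
      then show ?thesis
        using poly_cauchy_num[OF S(1), of x b c] zero[OF \<open>x \<in> T\<close>] by simp
    qed
    have "b s0 \<notin> T" using T s0 by auto
    then have card: "card (insert (b s0) T) = card S"
      using T by simp
    show "degree (cauchy_num S b c) < card (insert (b s0) T)"
      unfolding card by (rule degree_cauchy_num[OF S(1) ne])
    show "degree (smult k P) < card (insert (b s0) T)"
      unfolding card using degree_smult_le[of k P] dP T by linarith
  qed
  then have "c s * (\<Prod>r\<in>S - {s}. b r - b s) = k * (\<Prod>t\<in>T. b s - t)" if "s \<in> S" for s
    using poly_cauchy_num_node[OF S(1) that, of b c] by (simp add: P)
  then have "\<forall>s\<in>S. c s = k * ((\<Prod>t\<in>T. b s - t) / (\<Prod>r\<in>S - {s}. b r - b s))"
    using prod_node_diff_nonzero[OF S] by (simp add: field_simps)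
  then show ?thesis ..
qed

section \<open>Pochhammer and factorial identities\<close>

text \<open>Both sides are the Pochhammer symbol of \<open>a\<close> of length n + l, split at n or
  at l.\<close>

lemma pochhammer_shift_exchange:
  "pochhammer a n * pochhammer (a + of_nat n) l = pochhammer a l * pochhammer (a + of_nat l) n"
  by (metis add.commute pochhammer_product')

text \<open>Reversing the factors turns the two symbols of length \<open>l\<close> into those
  starting at d - l + m and d - l, with the common sign (-1)^l; then both sides are the symbol of d
  - l of length l + m.\<close>

lemma pochhammer_reflect_exchange:
  fixes d :: "'a::comm_ring_1"
  shows "pochhammer (1 - d - of_nat m) l * pochhammer (d - of_nat l) m =
    pochhammer (1 - d) l * pochhammer d m"
proof -
  have "pochhammer (1 - d - of_nat m) l = (-1) ^ l * pochhammer (d - of_nat l + of_nat m) l"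
    using pochhammer_minus[of "d + of_nat m - 1" l] by (simp add: algebra_simps)
  moreover have "pochhammer (1 - d) l = (-1) ^ l * pochhammer (d - of_nat l) l"
    using pochhammer_minus[of "d - 1" l] by (simp add: algebra_simps)
  ultimately show ?thesis
    using pochhammer_shift_exchange[of "d - of_nat l" m l] by (simp add: ac_simps)
qed

lemma pochhammer_neg_nat_times_fact:
  assumes "l \<le> M"
  shows "pochhammer (- of_nat M :: 'a::field_char_0) l * fact (M - l) = (-1) ^ l * fact M"
proof -
  have "pochhammer (- of_nat M :: 'a) l = (-1) ^ l * pochhammer (of_nat (M - l) + 1) l"
    using assms by (simp add: pochhammer_minus of_nat_diff)
  moreover have "fact M = fact (M - l) * pochhammer (of_nat (M - l) + 1 :: 'a) l"
    using assms pochhammer_product[of "M - l" M "1::'a"]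
    by (simp add: pochhammer_fact add.commute)
  ultimately show ?thesis
    by simp
qed

text \<open>The indices below \<open>k\<close> give (-1)^k k!, those above give (M - k - 1)!. This
  is the contribution of the poles \<open>\<beta> j + r\<close> to the residue at
  \<open>\<beta> j + k\<close>.\<close>

lemma prod_nat_diff_except:
  assumes "k < M"
  shows "(\<Prod>r\<in>{..<M} - {k}. of_nat r - of_nat k :: 'a::field_char_0) =
    (-1) ^ k * fact k * fact (M - k - 1)"
proof -
  have "{..<M} - {k} = {..<k} \<union> {Suc k..<M}"
    using assms by auto
  then have "(\<Prod>r\<in>{..<M} - {k}. of_nat r - of_nat k :: 'a) =
      (\<Prod>r<k. of_nat r - of_nat k) * (\<Prod>r\<in>{Suc k..<M}. of_nat r - of_nat k)"
    by (simp add: prod.union_disjoint disjoint_iff)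
  moreover have "(\<Prod>r<k. of_nat r - of_nat k :: 'a) = (-1) ^ k * fact k"
    using pochhammer_same[of k, where 'a = 'a] by (simp add: pochhammer_prod atLeast0LessThan)
  moreover have "(\<Prod>r\<in>{Suc k..<M}. of_nat r - of_nat k :: 'a) = pochhammer 1 (M - k - 1)"
    unfolding pochhammer_prod
    by (rule prod.reindex_bij_witness[of _ "\<lambda>i. i + Suc k" "\<lambda>r. r - Suc k"])
      (auto simp: of_nat_diff)
  ultimately show ?thesis
    by (simp add: pochhammer_fact)
qed

section \<open>Explicit coefficients and their hypergeometric generating polynomial\<close>

text \<open>This is the coefficient of 1 / (\<beta> j + k - t) in the partial fraction expansion of
  the rational factor of the contour integrand; see \<open>weight_eq\<close> and
  \<open>weight_partial_fractions\<close>.\<close>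

definition pineiro_coeff :: "nat \<Rightarrow> nat \<Rightarrow> (nat \<Rightarrow> real) \<Rightarrow> (nat \<Rightarrow> real) \<Rightarrow> (nat \<Rightarrow> nat) \<Rightarrow> (nat \<Rightarrow> nat) \<Rightarrow>
    nat \<Rightarrow> nat \<Rightarrow> real" where
  "pineiro_coeff p q \<alpha> \<beta> n m j k =
    (\<Prod>i=1..p. pochhammer (\<alpha> i + real k + \<beta> j + 1) (n i)) /
    ((\<Prod>i\<in>{1..q} - {j}. pochhammer (\<beta> i - \<beta> j - real k) (m i)) *
      fact k * fact (m j - k - 1) * (-1) ^ k)"

text \<open>The series terminates, and its terms match one by one: each shift by l moves between
  numerator and denominator through one of the exchange identities.\<close>

lemma pineiro_hypergeom:
  fixes \<alpha> \<beta> :: "nat \<Rightarrow> real" and n m :: "nat \<Rightarrow> nat"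
  assumes j: "j \<in> {1..q}" "m j \<ge> 1"
    and pos: "\<And>i. i \<in> {1..p} \<Longrightarrow> \<alpha> i + \<beta> j > -1"
    and nonint: "\<And>i. i \<in> {1..q} - {j} \<Longrightarrow> \<beta> j - \<beta> i \<notin> \<int>"
  shows "(\<Prod>i=1..p. pochhammer (\<alpha> i + \<beta> j + 1) (n i)) /
         (fact (m j - 1) * (\<Prod>i\<in>{1..q} - {j}. pochhammer (\<beta> i - \<beta> j) (m i))) *
         hypergeom
           ([- real (m j) + 1] @
            map (\<lambda>k. \<alpha> k + \<beta> j + real (n k) + 1) [1..<Suc p] @
            map (\<lambda>k. \<beta> j - \<beta> k - real (m k) + 1) (filter (\<lambda>k. k \<noteq> j) [1..<Suc q]))
           (map (\<lambda>k. \<alpha> k + \<beta> j + 1) [1..<Suc p] @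
            map (\<lambda>k. \<beta> j - \<beta> k + 1) (filter (\<lambda>k. k \<noteq> j) [1..<Suc q]))
           x = (\<Sum>k<m j. pineiro_coeff p q \<alpha> \<beta> n m j k * x ^ k)"
    (is "?A * hypergeom ?as ?bs x = _")
proof -
  let ?I = "{1..p}" and ?J = "{1..q} - {j}"
  have setJ: "set (filter (\<lambda>k. k \<noteq> j) [1..<Suc q]) = ?J"
    by auto
  have listI: "prod_list (map f [1..<Suc p]) = prod f ?I" for f :: "nat \<Rightarrow> real"
    by (subst prod.distinct_set_conv_list[symmetric])
      (auto simp del: upt_Suc simp: atLeastLessThanSuc_atLeastAtMost)
  have listJ: "prod_list (map f (filter (\<lambda>k. k \<noteq> j) [1..<Suc q])) = prod f ?J"
    for f :: "nat \<Rightarrow> real"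
    by (subst prod.distinct_set_conv_list[symmetric]) (auto simp only: setJ distinct_filter distinct_upt)
  have nonint': "\<beta> j - \<beta> i \<noteq> of_int z" if "i \<in> ?J" for i z
    using nonint[OF that] by auto
  define t where "t l = (\<Prod>a\<leftarrow>?as. pochhammer a l) / (\<Prod>b\<leftarrow>?bs. pochhammer b l) * (x ^ l / fact l)" for l
  \<comment> \<open>The parameters are brought to the shapes a + n, 1 - d - m and 1 - d with d =
    \<beta> i - \<beta> j, as the exchange identities expect them.\<close>
  have t: "t l = pochhammer (- real (m j - 1)) l *
      (\<Prod>i\<in>?I. pochhammer (\<alpha> i + \<beta> j + 1 + real (n i)) l) *
      (\<Prod>i\<in>?J. pochhammer (1 - (\<beta> i - \<beta> j) - real (m i)) l) /
      ((\<Prod>i\<in>?I. pochhammer (\<alpha> i + \<beta> j + 1) l) *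
       (\<Prod>i\<in>?J. pochhammer (1 - (\<beta> i - \<beta> j)) l)) * (x ^ l / fact l)" for l
  proof -
    have "- real (m j) + 1 = - real (m j - 1)"
      using j by (simp add: of_nat_diff)
    then show ?thesis
      unfolding t_def map_append map_map o_def prod_list.append listI listJ
      by (simp add: algebra_simps)
  qed
  have "hypergeom ?as ?bs x = (\<Sum>l. t l)"
    by (simp only: hypergeom_series t_def)
  also have "\<dots> = (\<Sum>l<m j. t l)"
  proof (rule suminf_finite)
    fix l assume "l \<notin> {..<m j}"
    \<comment> \<open>The upper parameter -(m j - 1) is a nonpositive integer, so its symbol
      contains the factor 0 as soon as l exceeds m j - 1.\<close>
    then have "pochhammer (- real (m j - 1)) l = 0"
      using j by (intro pochhammer_of_nat_eq_0_lemma) auto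
    then show "t l = 0" by (simp add: t)
  qed simp
  finally have "?A * hypergeom ?as ?bs x = (\<Sum>l<m j. ?A * t l)"
    by (simp add: sum_distrib_left)
  also have "\<dots> = (\<Sum>l<m j. pineiro_coeff p q \<alpha> \<beta> n m j l * x ^ l)"
  proof (rule sum.cong[OF refl])
    fix l assume "l \<in> {..<m j}"
    then have l: "l < m j" by simp
    have 1: "(\<Prod>i\<in>?I. pochhammer (\<alpha> i + \<beta> j + 1) (n i)) *
        (\<Prod>i\<in>?I. pochhammer (\<alpha> i + \<beta> j + 1 + real (n i)) l) =
        (\<Prod>i\<in>?I. pochhammer (\<alpha> i + \<beta> j + 1) l) *
        (\<Prod>i\<in>?I. pochhammer (\<alpha> i + real l + \<beta> j + 1) (n i))"
    proof -
      have "\<alpha> i + real l + \<beta> j + 1 = \<alpha> i + \<beta> j + 1 + real l" for i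
        by simp
      then show ?thesis
        unfolding prod.distrib[symmetric]
        by (intro prod.cong refl) (simp only: pochhammer_shift_exchange[of _ _ l])
    qed
    have 2: "(\<Prod>i\<in>?J. pochhammer (1 - (\<beta> i - \<beta> j) - real (m i)) l) *
        (\<Prod>i\<in>?J. pochhammer (\<beta> i - \<beta> j - real l) (m i)) =
        (\<Prod>i\<in>?J. pochhammer (1 - (\<beta> i - \<beta> j)) l) *
        (\<Prod>i\<in>?J. pochhammer (\<beta> i - \<beta> j) (m i))"
      by (simp only: prod.distrib[symmetric] pochhammer_reflect_exchange)
    have 3: "pochhammer (- real (m j - 1)) l * fact (m j - l - 1) = (-1) ^ l * fact (m j - 1)"
      using pochhammer_neg_nat_times_fact[of l "m j - 1", where 'a = real] l by (simp add: diff_commute)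
    have nz1: "(\<Prod>i\<in>?I. pochhammer (\<alpha> i + \<beta> j + 1) l) \<noteq> 0"
      using pos by (auto simp: pochhammer_eq_0_iff) (smt (verit) of_nat_0_le_iff)
    have nz2: "(\<Prod>i\<in>?J. pochhammer (1 - (\<beta> i - \<beta> j)) l) \<noteq> 0"
    proof -
      \<comment> \<open>A vanishing factor would make \<beta> j - \<beta> i an integer; the same
        argument serves \<open>nz3\<close> and \<open>nz4\<close>.\<close>
      have False if "i \<in> ?J" "1 - (\<beta> i - \<beta> j) = - real k" for i k
        using nonint'[OF that(1), of "- int k - 1"] that(2) by simp
      then show ?thesis
        unfolding prod_zero_iff[OF finite_Diff[OF finite_atLeastAtMost]] pochhammer_eq_0_iff by blast
    qed
    have nz3: "(\<Prod>i\<in>?J. pochhammer (\<beta> i - \<beta> j) (m i)) \<noteq> 0"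
    proof -
      have False if "i \<in> ?J" "\<beta> i - \<beta> j = - real k" for i k
        using nonint'[OF that(1), of "int k"] that(2) by simp
      then show ?thesis
        unfolding prod_zero_iff[OF finite_Diff[OF finite_atLeastAtMost]] pochhammer_eq_0_iff by blast
    qed
    have nz4: "(\<Prod>i\<in>?J. pochhammer (\<beta> i - \<beta> j - real l) (m i)) \<noteq> 0"
    proof -
      have False if "i \<in> ?J" "\<beta> i - \<beta> j - real l = - real k" for i k
        using nonint'[OF that(1), of "int k - int l"] that(2) by simp
      then show ?thesis
        unfolding prod_zero_iff[OF finite_Diff[OF finite_atLeastAtMost]] pochhammer_eq_0_iff by blast
    qed
    have sgn: "((-1) ^ l :: real) * (-1) ^ l = 1"
      by (simp add: power_mult_distrib[symmetric])
    \<comment> \<open>Field arithmetic with the products abstracted: a stands for \<alpha>-products,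
      b for \<beta>-products, f for factorials and e for the sign (-1)^l, which e * e = 1 moves into
      the denominator.\<close>
    have arith: "a1 / (f1 * b1) * (u * a2 * b2 / (a3 * b3) * (x ^ l / fact l)) =
        a4 / (b4 * fact l * f2 * e) * x ^ l"
      if "a1 * a2 = a3 * a4" "b2 * b4 = b3 * b1" "u * f2 = e * f1" "a3 \<noteq> 0" "b3 \<noteq> 0"
        "b1 \<noteq> 0" "b4 \<noteq> 0" "f1 \<noteq> 0" "f2 \<noteq> 0" "e * e = 1"
      for a1 a2 a3 a4 b1 b2 b3 b4 f1 f2 u e :: real
    proof -
      have "a1 * (u * a2 * b2 * x ^ l) * (b4 * fact l * f2 * e) =
          (a1 * a2) * (b2 * b4) * (u * f2) * e * fact l * x ^ l"
        by (simp only: ac_simps)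
      also have "\<dots> = a4 * x ^ l * (f1 * b1 * (a3 * b3 * fact l)) * (e * e)"
        unfolding that(1-3) by (simp only: ac_simps)
      finally have *: "a1 * (u * a2 * b2 * x ^ l) * (b4 * fact l * f2 * e) =
          a4 * x ^ l * (f1 * b1 * (a3 * b3 * fact l))"
        using that by simp
      have "e \<noteq> 0" using that by auto
      have "a1 / (f1 * b1) * (u * a2 * b2 / (a3 * b3) * (x ^ l / fact l)) =
          (a1 * (u * a2 * b2 * x ^ l)) / (f1 * b1 * (a3 * b3 * fact l))"
        by simp
      also have "\<dots> = (a4 * x ^ l) / (b4 * fact l * f2 * e)"
        using * that \<open>e \<noteq> 0\<close> by (subst frac_eq_eq) auto
      finally show ?thesis by simp
    qed
    show "?A * t l = pineiro_coeff p q \<alpha> \<beta> n m j l * x ^ l"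
      unfolding t pineiro_coeff_def
      by (rule arith[OF 1 2 3 nz1 nz2 nz3 nz4 _ _ sgn]) auto
  qed
  finally show ?thesis .
qed

section \<open>Poles, zeros and weights of the rational integrand\<close>

text \<open>A coincidence with i and h distinct would make g i - g h an integer. The lemma serves
  both the poles (from \<beta>) and the zeros (from \<alpha>).\<close>

lemma nat_shift_inj_on:
  fixes g :: "nat \<Rightarrow> real"
  assumes "\<And>i h. i \<in> I \<Longrightarrow> h \<in> I \<Longrightarrow> i \<noteq> h \<Longrightarrow> g i - g h \<notin> \<int>"
  shows "inj_on (\<lambda>s. g (fst s) + real (snd s)) (SIGMA i:I. {..<N i})"
proof (rule inj_onI, clarsimp)
  fix i k h l assume *: "i \<in> I" "h \<in> I" "g i + real k = g h + real l"
  then have "g i - g h = of_int (int l - int k)" by simp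
  then have "g i - g h \<in> \<int>" by (metis Ints_of_int)
  then have "i = h" using assms * by blast
  then show "i = h \<and> k = l" using * by simp
qed

locale pineiro_system =
  fixes p q :: nat and \<alpha> \<beta> :: "nat \<Rightarrow> real" and n m :: "nat \<Rightarrow> nat"
  assumes beta_gt: "j \<in> {1..q} \<Longrightarrow> \<beta> j > -1"
    and sum_gt: "i \<in> {1..p} \<Longrightarrow> j \<in> {1..q} \<Longrightarrow> \<alpha> i + \<beta> j > -1"
    and alpha_nonint: "i \<in> {1..p} \<Longrightarrow> h \<in> {1..p} \<Longrightarrow> i \<noteq> h \<Longrightarrow> \<alpha> i - \<alpha> h \<notin> \<int>"
    and beta_nonint: "j \<in> {1..q} \<Longrightarrow> s \<in> {1..q} \<Longrightarrow> j \<noteq> s \<Longrightarrow> \<beta> j - \<beta> s \<notin> \<int>"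
    and size_eq: "(\<Sum>j=1..q. m j) = (\<Sum>i=1..p. n i) + 1"
begin

text \<open>A pair (j, k) stands for the power with exponent \<beta> j + k, so the coefficients of
  all components form a single family over |m| indices.\<close>

definition idx :: "(nat \<times> nat) set" where
  "idx = (SIGMA j:{1..q}. {..<m j})"

definition node :: "nat \<times> nat \<Rightarrow> real" where
  "node s = \<beta> (fst s) + real (snd s)"

definition zeros :: "real set" where
  "zeros = (\<lambda>s. - (\<alpha> (fst s) + real (snd s) + 1)) ` (SIGMA i:{1..p}. {..<n i})"

definition weight :: "nat \<times> nat \<Rightarrow> real" where
  "weight s = pineiro_coeff p q \<alpha> \<beta> n m (fst s) (snd s)"

lemma finite_idx [simp]: "finite idx"
  by (simp add: idx_def)

lemma finite_zeros [simp]: "finite zeros"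
  by (simp add: zeros_def)

lemma sum_idx: "(\<Sum>s\<in>idx. f (fst s) (snd s)) = (\<Sum>j=1..q. \<Sum>k<m j. f j k)"
  unfolding idx_def by (subst sum.Sigma) (auto simp: case_prod_beta)

lemma inj_node: "inj_on node idx"
  unfolding idx_def node_def by (rule nat_shift_inj_on) (rule beta_nonint)

lemma inj_zeros: "inj_on (\<lambda>s. - (\<alpha> (fst s) + real (snd s) + 1)) (SIGMA i:{1..p}. {..<n i})"
proof -
  have "inj_on (\<lambda>s. \<alpha> (fst s) + real (snd s)) (SIGMA i:{1..p}. {..<n i})"
    by (rule nat_shift_inj_on) (rule alpha_nonint)
  moreover have "inj_on (\<lambda>y::real. - (y + 1)) A" for A
    by (rule inj_onI) simp
  ultimately show ?thesis
    using comp_inj_on unfolding o_def by blast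
qed

text \<open>As poles and zeros are each pairwise distinct, |m| = |n| + 1 becomes one pole more than
  zeros, the count behind uniqueness up to a factor.\<close>

lemma card_idx: "card idx = card zeros + 1"
  using size_eq unfolding zeros_def card_image[OF inj_zeros] by (simp add: idx_def)

text \<open>From \<alpha> i + \<beta> j > -1 one gets -(\<alpha> i + 1) < \<beta> j, and the shifts
  only widen the gap. Hence no zero cancels a pole.\<close>

lemma zeros_disjoint:
  assumes "s \<in> idx" "t \<in> zeros"
  shows "t < node s"
proof -
  obtain i k where "i \<in> {1..p}" "t = - (\<alpha> i + real k + 1)"
    using assms(2) by (auto simp: zeros_def)
  moreover have "fst s \<in> {1..q}"
    using assms(1) by (auto simp: idx_def)
  ultimately show ?thesis
    using sum_gt[of i "fst s"] by (simp add: node_def)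
qed

text \<open>The field is kept generic because orthogonality uses the real instance and the contour
  integral the complex one.\<close>

lemma prod_zeros:
  "(\<Prod>t\<in>zeros. x - of_real t) = (\<Prod>i=1..p. pochhammer (x + of_real (\<alpha> i) + 1) (n i))"
  for x :: "'a::real_field"
proof -
  have "(\<Prod>t\<in>zeros. x - of_real t) =
      (\<Prod>s\<in>(SIGMA i:{1..p}. {..<n i}). x + of_real (\<alpha> (fst s)) + 1 + of_nat (snd s))"
    unfolding zeros_def by (subst prod.reindex[OF inj_zeros]) (simp add: algebra_simps)
  also have "\<dots> = (\<Prod>i=1..p. \<Prod>k<n i. x + of_real (\<alpha> i) + 1 + of_nat k)"
    by (subst prod.Sigma) (auto simp: case_prod_beta)
  finally show ?thesis
    by (simp add: pochhammer_prod atLeast0LessThan)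
qed

lemma prod_nodes:
  "(\<Prod>s\<in>idx. of_real (node s) - t) = (\<Prod>j=1..q. pochhammer (of_real (\<beta> j) - t) (m j))"
  for t :: "'a::real_field"
proof -
  have "(\<Prod>s\<in>idx. of_real (node s) - t) = (\<Prod>j=1..q. \<Prod>k<m j. of_real (\<beta> j) - t + of_nat k)"
    unfolding idx_def node_def
    by (subst prod.Sigma) (auto simp: case_prod_beta algebra_simps)
  then show ?thesis
    by (simp add: pochhammer_prod atLeast0LessThan)
qed

text \<open>The other nodes split in two groups: those with another first index i give the
  Pochhammer symbols of \<beta> i - \<beta> j - k, those with the same j give the signed
  factorials.\<close>

lemma weight_eq:
  assumes s: "s \<in> idx"
  shows "weight s = (\<Prod>t\<in>zeros. node s - t) / (\<Prod>r\<in>idx - {s}. node r - node s)"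
proof -
  obtain j k where jk: "s = (j, k)" "j \<in> {1..q}" "k < m j"
    using s by (auto simp: idx_def)
  have "idx - {s} = (SIGMA i:{1..q} - {j}. {..<m i}) \<union> {j} \<times> ({..<m j} - {k})"
    using jk by (auto simp: idx_def)
  then have "(\<Prod>r\<in>idx - {s}. node r - node s) =
      (\<Prod>r\<in>(SIGMA i:{1..q} - {j}. {..<m i}). node r - node s) *
      (\<Prod>r\<in>{j} \<times> ({..<m j} - {k}). node r - node s)"
    by (simp only:, intro prod.union_disjoint) auto
  also have "(\<Prod>r\<in>(SIGMA i:{1..q} - {j}. {..<m i}). node r - node s) =
      (\<Prod>i\<in>{1..q} - {j}. \<Prod>l<m i. \<beta> i - \<beta> j - real k + real l)"
    by (subst prod.Sigma) (auto simp: case_prod_beta node_def jk algebra_simps)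
  also have "(\<Prod>r\<in>{j} \<times> ({..<m j} - {k}). node r - node s) =
      (\<Prod>l\<in>{..<m j} - {k}. real l - real k)"
    by (rule prod.reindex_bij_witness[of _ "\<lambda>l. (j, l)" snd]) (auto simp: node_def jk)
  also have "\<dots> = (-1) ^ k * fact k * fact (m j - k - 1)"
    by (rule prod_nat_diff_except) (use jk in auto)
  finally show ?thesis
    using prod_zeros[of "node s"]
    by (simp add: weight_def pineiro_coeff_def jk node_def pochhammer_prod atLeast0LessThan ac_simps)
qed

lemma weight_nonzero:
  assumes "s \<in> idx"
  shows "weight s \<noteq> 0"
proof -
  have "(\<Prod>t\<in>zeros. node s - t) \<noteq> 0"
    using zeros_disjoint[OF assms] by (simp add: prod_zero_iff) force
  then show ?thesis
    using prod_node_diff_nonzero[OF finite_idx inj_node assms] by (simp only: weight_eq[OF assms]) simp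
qed

text \<open>The numerator has degree |n| < |m|, so the fraction is proper, and
  \<open>weight_eq\<close> identifies its interpolation coefficients.\<close>

lemma weight_partial_fractions:
  fixes t :: "'a::real_field"
  assumes "t \<notin> (\<lambda>s. of_real (node s)) ` idx"
  shows "(\<Prod>i=1..p. pochhammer (t + of_real (\<alpha> i) + 1) (n i)) /
      (\<Prod>j=1..q. pochhammer (of_real (\<beta> j) - t) (m j)) =
    (\<Sum>s\<in>idx. of_real (weight s) / (of_real (node s) - t))"
proof -
  define P :: "'a poly" where "P = (\<Prod>z\<in>zeros. [:- of_real z, 1:])"
  have P: "poly P x = (\<Prod>z\<in>zeros. x - of_real z)" for x
    by (simp add: P_def poly_prod)
  have "degree P = card zeros"
    unfolding P_def by (subst degree_prod_sum_eq) auto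
  then have deg: "degree P < card idx"
    by (simp add: card_idx)
  have inj: "inj_on (\<lambda>s. of_real (node s) :: 'a) idx"
    using inj_node by (auto simp: inj_on_def)
  have "of_real (weight s) =
      poly P (of_real (node s)) / (\<Prod>r\<in>idx - {s}. of_real (node r) - of_real (node s))"
    if "s \<in> idx" for s
    using that by (simp add: P weight_eq)
  then show ?thesis
    using partial_fractions[OF finite_idx inj deg assms]
    by (simp add: P prod_zeros prod_nodes)
qed

section \<open>Orthogonality and independence of the powers\<close>

text \<open>At x = 0 both sides are 0 by the value of \<open>powr\<close> at base 0, so the
  expansion is available on the whole closed interval of integration.\<close>

lemma mixed_form_powers:
  assumes deg: "\<forall>j\<in>{1..q}. if m j = 0 then B j = 0 else degree (B j) \<le> m j - 1" and x: "x \<ge> 0"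
  shows "mixed_form q \<beta> B x = (\<Sum>s\<in>idx. coeff (B (fst s)) (snd s) * x powr node s)"
proof -
  have "poly (B j) x * x powr \<beta> j = (\<Sum>k<m j. coeff (B j) k * x powr (\<beta> j + real k))"
    if j: "j \<in> {1..q}" for j
  proof (cases "x = 0")
    case False
    have "poly (B j) x = (\<Sum>k<m j. coeff (B j) k * x ^ k)"
    proof (cases "m j = 0")
      case True
      then show ?thesis using deg j by auto
    next
      case False
      then have "degree (B j) < m j" using deg j by fastforce
      then have "(\<Sum>k\<le>degree (B j). coeff (B j) k * x ^ k) = (\<Sum>k<m j. coeff (B j) k * x ^ k)"
        by (intro sum.mono_neutral_left) (auto simp: coeff_eq_0)
      then show ?thesis by (simp add: poly_altdef)
    qed
    then show ?thesis
      using x False by (simp add: sum_distrib_left sum_distrib_right powr_add powr_realpow ac_simps)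
  qed auto
  then show ?thesis
    unfolding mixed_form_def node_def
      sum_idx[of "\<lambda>j k. coeff (B j) k * x powr (\<beta> j + real k)"] by simp
qed

text \<open>Termwise, x^(b + a) has integral 1 / (b + a + 1) when b + a > -1. The denominator is
  written as a difference so that the result is a sum of simple fractions at -(a + 1).\<close>

lemma power_sum_integral:
  assumes "\<And>s. s \<in> idx \<Longrightarrow> node s + a > -1"
  shows "((\<lambda>x. (\<Sum>s\<in>idx. c s * x powr node s) * x powr a) has_integral
    (\<Sum>s\<in>idx. c s / (node s - (- (a + 1))))) {0..1}"
proof -
  have "((\<lambda>x. c s * x powr (node s + a)) has_integral c s / (node s - (- (a + 1)))) {0..1}"
    if "s \<in> idx" for s
    using has_integral_mult_right[OF has_integral_powr_from_0[OF assms[OF that], of 1], of "c s"]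
    by (simp add: algebra_simps)
  then have "((\<lambda>x. \<Sum>s\<in>idx. c s * x powr (node s + a)) has_integral
      (\<Sum>s\<in>idx. c s / (node s - (- (a + 1))))) {0..1}"
    by (intro has_integral_sum) auto
  then show ?thesis
    by (simp add: powr_add sum_distrib_right mult.assoc)
qed

lemma orthogonality_iff:
  assumes deg: "\<forall>j\<in>{1..q}. if m j = 0 then B j = 0 else degree (B j) \<le> m j - 1"
  shows "(\<forall>i\<in>{1..p}. \<forall>k<n i.
      ((\<lambda>x. mixed_form q \<beta> B x * x powr (real k + \<alpha> i)) has_integral 0) {0..1}) \<longleftrightarrow>
    (\<forall>t\<in>zeros. (\<Sum>s\<in>idx. coeff (B (fst s)) (snd s) / (node s - t)) = 0)"
proof -
  have "((\<lambda>x. mixed_form q \<beta> B x * x powr (real k + \<alpha> i)) has_integral 0) {0..1} \<longleftrightarrow>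
      (\<Sum>s\<in>idx. coeff (B (fst s)) (snd s) / (node s - (- (\<alpha> i + real k + 1)))) = 0"
    (is "(?f has_integral 0) _ \<longleftrightarrow> ?S = 0") if "i \<in> {1..p}" for i k
  proof -
    have "node s + (real k + \<alpha> i) > -1" if "s \<in> idx" for s
      using sum_gt[OF \<open>i \<in> {1..p}\<close>, of "fst s"] that by (auto simp: node_def idx_def)
    from power_sum_integral[OF this, of "\<lambda>s. coeff (B (fst s)) (snd s)"]
    have "((\<lambda>x. (\<Sum>s\<in>idx. coeff (B (fst s)) (snd s) * x powr node s) * x powr (real k + \<alpha> i))
        has_integral ?S) {0..1}"
      by (simp add: ac_simps)
    then have "(?f has_integral ?S) {0..1}"
      by (rule has_integral_eq[rotated]) (simp add: mixed_form_powers[OF deg])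
    then show ?thesis
      using has_integral_unique[of ?f ?S "{0..1}" 0] by auto
  qed
  then show ?thesis
    by (auto simp: zeros_def)
qed

lemma powers_independent:
  assumes zero: "\<And>x. x \<in> {0<..<1} \<Longrightarrow> (\<Sum>s\<in>idx. c s * x powr node s) = 0" and s: "s \<in> idx"
  shows "c s = 0"
proof (rule cauchy_sum_zeros_trivial[OF finite_idx inj_node _ _ _ s])
  \<comment> \<open>Testing against x^k for k below \<open>card idx\<close> yields as many zeros as
    there are nodes. The bound \<open>\<beta> j > -1\<close> puts all of them to the left of the
    nodes and makes the integrals converge.\<close>
  let ?T = "(\<lambda>k. - (real k + 1)) ` {..<card idx}"
  have gt: "node s > -1" if "s \<in> idx" for s
    using that beta_gt[of "fst s"] by (auto simp: node_def idx_def)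
  show "?T \<inter> node ` idx = {}"
    using gt by fastforce
  show "card idx \<le> card ?T"
    by (subst card_image) (auto simp: inj_on_def)
  show "(\<Sum>s\<in>idx. c s / (node s - t)) = 0" if "t \<in> ?T" for t
  proof -
    obtain k where k: "t = - (real k + 1)" using \<open>t \<in> ?T\<close> by auto
    have "node s + real k > -1" if "s \<in> idx" for s
      using gt[OF that] by linarith
    then have "((\<lambda>x. (\<Sum>s\<in>idx. c s * x powr node s) * x powr real k) has_integral
        (\<Sum>s\<in>idx. c s / (node s - t))) {0..1}"
      unfolding k by (rule power_sum_integral)
    \<comment> \<open>The vanishing is known only on the open interval; the two endpoints do not
      affect the integral.\<close>
    moreover have "((\<lambda>x. (\<Sum>s\<in>idx. c s * x powr node s) * x powr real k) has_integral 0) {0..1}"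
      by (rule has_integral_spike_finite[where S = "{0, 1}" and f = "\<lambda>_. 0"]) (auto simp: zero)
    ultimately show ?thesis
      by (rule has_integral_unique)
  qed
qed

section \<open>Evaluation of the contour integral\<close>

lemma contour_form_eq:
  assumes \<gamma>: "pineiro_contour q \<beta> m \<gamma>" and x: "x > 0"
  shows "contour_form p q \<alpha> \<beta> n m \<gamma> x = of_real (\<Sum>s\<in>idx. weight s * x powr node s)"
proof -
  let ?w = "\<lambda>s. complex_of_real (node s)"
  have path: "valid_path \<gamma>" "pathfinish \<gamma> = pathstart \<gamma>"
    using \<gamma> by (auto simp: pineiro_contour_def)
  have off: "?w s \<notin> path_image \<gamma>" and wind: "winding_number \<gamma> (?w s) = -1" if "s \<in> idx" for s
    using \<gamma> that by (auto simp: pineiro_contour_def idx_def node_def)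
  \<comment> \<open>The minus sign comes from 1 / (b - t) = -1 / (t - b) and cancels the winding
    number -1. For x > 0 the function x^t is entire in t, so Cauchy's formula applies on the whole
    plane.\<close>
  have "((\<lambda>t. (- of_real (weight s) * of_real x powr t) / (t - ?w s)) has_contour_integral
      2 * pi * \<i> * of_real (weight s * x powr node s)) \<gamma>" if "s \<in> idx" for s
  proof -
    have "(\<lambda>t. - of_real (weight s) * of_real x powr t) holomorphic_on UNIV"
      using x by (intro holomorphic_intros) auto
    from Cauchy_integral_formula_convex_simple[OF convex_UNIV this, of "?w s" \<gamma>]
    show ?thesis
      using path off[OF that] wind[OF that] x by (auto simp: powr_of_real ac_simps)
  qed
  then have "((\<lambda>t. \<Sum>s\<in>idx. (- of_real (weight s) * of_real x powr t) / (t - ?w s))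
      has_contour_integral (\<Sum>s\<in>idx. 2 * pi * \<i> * of_real (weight s * x powr node s))) \<gamma>"
    by (intro has_contour_integral_sum) auto
  then have "((\<lambda>t. of_real x powr t * (\<Prod>i=1..p. pochhammer (t + of_real (\<alpha> i) + 1) (n i)) /
      (\<Prod>j=1..q. pochhammer (of_real (\<beta> j) - t) (m j))) has_contour_integral
      (\<Sum>s\<in>idx. 2 * pi * \<i> * of_real (weight s * x powr node s))) \<gamma>"
  proof (rule has_contour_integral_eq)
    \<comment> \<open>Equality of the integrands is only required on the path, which avoids all
      poles.\<close>
    fix t assume t: "t \<in> path_image \<gamma>"
    have "(- of_real (weight s) * of_real x powr t) / (t - ?w s) =
        of_real x powr t * (of_real (weight s) / (?w s - t))" for s
    proof -
      have "(- of_real (weight s) * of_real x powr t) / (t - ?w s) =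
          (- (of_real x powr t * of_real (weight s))) / (- (?w s - t))"
        by (simp add: mult.commute)
      then show ?thesis
        by (simp only: minus_divide_divide times_divide_eq_right)
    qed
    then have "(\<Sum>s\<in>idx. (- of_real (weight s) * of_real x powr t) / (t - ?w s)) =
        of_real x powr t * (\<Sum>s\<in>idx. of_real (weight s) / (?w s - t))"
      by (simp only: sum_distrib_left)
    also have "t \<notin> ?w ` idx"
      using t off by auto
    note weight_partial_fractions[OF this, symmetric]
    finally show "(\<Sum>s\<in>idx. (- of_real (weight s) * of_real x powr t) / (t - ?w s)) =
        of_real x powr t * (\<Prod>i=1..p. pochhammer (t + of_real (\<alpha> i) + 1) (n i)) /
        (\<Prod>j=1..q. pochhammer (of_real (\<beta> j) - t) (m j))"
      by (simp only: times_divide_eq_right)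
  qed
  from contour_integral_unique[OF this] show ?thesis
    unfolding contour_form_def sum_distrib_left[symmetric] by simp
qed

section \<open>Existence and uniqueness up to a factor\<close>

text \<open>Taking the weights as coefficients gives a fraction whose numerator vanishes on
  \<open>zeros\<close>; since no weight is 0, independence of the powers makes the form
  nonzero.\<close>

lemma typeII_exists: "\<exists>B. typeII_pineiro p q \<alpha> \<beta> n m B"
proof -
  define B where "B j = (\<Sum>k<m j. monom (weight (j, k)) k)" for j
  have coeff: "coeff (B (fst s)) (snd s) = weight s" if "s \<in> idx" for s
    using that by (auto simp: B_def coeff_sum coeff_monom idx_def)
  have deg: "\<forall>j\<in>{1..q}. if m j = 0 then B j = 0 else degree (B j) \<le> m j - 1"
    by (auto simp: B_def intro!: degree_sum_le degree_monom_le[THEN order_trans])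
  have "(\<Sum>s\<in>idx. weight s / (node s - t)) = 0" if "t \<in> zeros" for t
  proof -
    have "t \<notin> node ` idx"
      using zeros_disjoint that by force
    moreover have "(\<Prod>i=1..p. pochhammer (t + \<alpha> i + 1) (n i)) = 0"
      using prod_zeros[of t] prod_zero[OF finite_zeros, of "\<lambda>z. t - z"] that by auto
    ultimately show ?thesis
      using weight_partial_fractions[of t] by (simp del: prod_zero_iff)
  qed
  then have orth: "\<forall>t\<in>zeros. (\<Sum>s\<in>idx. coeff (B (fst s)) (snd s) / (node s - t)) = 0"
    using coeff by simp
  obtain s where s: "s \<in> idx"
    using card_idx by (metis card.empty add_is_0 all_not_in_conv zero_neq_one)
  have "\<exists>x\<in>{0<..<1}. mixed_form q \<beta> B x \<noteq> 0"
  proof (rule ccontr)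
    assume "\<not> ?thesis"
    then have "(\<Sum>s\<in>idx. coeff (B (fst s)) (snd s) * x powr node s) = 0" if "x \<in> {0<..<1}" for x
      using that mixed_form_powers[OF deg, of x] by auto
    from powers_independent[OF this s] show False
      using coeff[OF s] weight_nonzero[OF s] by simp
  qed
  then show ?thesis
    using deg orth orthogonality_iff[OF deg] unfolding typeII_pineiro_def by blast
qed

text \<open>Uniqueness of the numerator gives the common factor, and it is nonzero because the form
  does not vanish identically.\<close>

lemma typeII_coeff:
  assumes B: "typeII_pineiro p q \<alpha> \<beta> n m B"
  obtains c where "c \<noteq> 0" "\<And>s. s \<in> idx \<Longrightarrow> coeff (B (fst s)) (snd s) = c * weight s"
proof -
  have deg: "\<forall>j\<in>{1..q}. if m j = 0 then B j = 0 else degree (B j) \<le> m j - 1"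
    using B unfolding typeII_pineiro_def by blast
  have "\<forall>t\<in>zeros. (\<Sum>s\<in>idx. coeff (B (fst s)) (snd s) / (node s - t)) = 0"
    using B orthogonality_iff[OF deg] unfolding typeII_pineiro_def by blast
  moreover have "zeros \<inter> node ` idx = {}"
    using zeros_disjoint by force
  ultimately obtain c where c: "coeff (B (fst s)) (snd s) = c * weight s" if "s \<in> idx" for s
    using cauchy_sum_zeros_unique[OF finite_idx inj_node finite_zeros _ card_idx,
        of "\<lambda>s. coeff (B (fst s)) (snd s)"] weight_eq by (metis (no_types, lifting))
  obtain x where x: "x \<in> {0<..<1}" "mixed_form q \<beta> B x \<noteq> 0"
    using B by (auto simp: typeII_pineiro_def)
  have "c \<noteq> 0"
    using x mixed_form_powers[OF deg, of x] c by auto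
  then show ?thesis
    using c that by blast
qed

end

section \<open>Component formulas and the contour normalization\<close>

theorem corollary5p5:
  fixes p q :: nat and \<alpha> \<beta> :: "nat \<Rightarrow> real" and n m :: "nat \<Rightarrow> nat"
  assumes "p \<ge> 1" and "q \<ge> 1"
    and "\<forall>i\<in>{1..p}. \<alpha> i > -1"
    and "\<forall>j\<in>{1..q}. \<beta> j > -1"
    and "\<forall>i\<in>{1..p}. \<forall>j\<in>{1..q}. \<alpha> i + \<beta> j > -1"
    and "\<forall>i\<in>{1..p}. \<forall>h\<in>{1..p}. i \<noteq> h \<longrightarrow> \<alpha> i - \<alpha> h \<notin> \<int>"
    and "\<forall>j\<in>{1..q}. \<forall>s\<in>{1..q}. j \<noteq> s \<longrightarrow> \<beta> j - \<beta> s \<notin> \<int>"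
    and "(\<Sum>j=1..q. m j) = (\<Sum>i=1..p. n i) + 1"
  shows
    "(\<exists>B. typeII_pineiro p q \<alpha> \<beta> n m B) \<and>
     (\<forall>B. typeII_pineiro p q \<alpha> \<beta> n m B \<longrightarrow>
       (\<exists>c. c \<noteq> 0 \<and>
         (\<forall>j\<in>{1..q}. m j \<ge> 1 \<longrightarrow>
           (\<forall>x. poly (B j) x =
              c * ((\<Prod>i=1..p. pochhammer (\<alpha> i + \<beta> j + 1) (n i)) /
                   (fact (m j - 1) * (\<Prod>i\<in>{1..q} - {j}. pochhammer (\<beta> i - \<beta> j) (m i))) *
                   hypergeom
                     ([- real (m j) + 1] @
                      map (\<lambda>k. \<alpha> k + \<beta> j + real (n k) + 1) [1..<Suc p] @
                      map (\<lambda>k. \<beta> j - \<beta> k - real (m k) + 1) (filter (\<lambda>k. k \<noteq> j) [1..<Suc q]))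
                     (map (\<lambda>k. \<alpha> k + \<beta> j + 1) [1..<Suc p] @
                      map (\<lambda>k. \<beta> j - \<beta> k + 1) (filter (\<lambda>k. k \<noteq> j) [1..<Suc q]))
                     x)) \<and>
           (\<forall>k\<le>m j - 1. coeff (B j) k =
              c * ((\<Prod>i=1..p. pochhammer (\<alpha> i + real k + \<beta> j + 1) (n i)) /
                   ((\<Prod>i\<in>{1..q} - {j}. pochhammer (\<beta> i - \<beta> j - real k) (m i)) *
                    fact k * fact (m j - k - 1) * (-1) ^ k))) \<and>
           lead_coeff (B j) = coeff (B j) (m j - 1) \<and>
           coeff (B j) (m j - 1) =
              c * ((\<Prod>i=1..p. pochhammer (\<beta> j + real (m j) + \<alpha> i) (n i)) /
                   ((\<Prod>i\<in>{1..q} - {j}. pochhammer (\<beta> i - \<beta> j - real (m j) + 1) (m i)) *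
                    fact (m j - 1) * (-1) ^ (m j - 1)))) \<and>
         (\<forall>\<gamma>. pineiro_contour q \<beta> m \<gamma> \<longrightarrow>
           ((\<forall>x\<in>{0<..<1}. of_real (mixed_form q \<beta> B x) = contour_form p q \<alpha> \<beta> n m \<gamma> x)
             \<longleftrightarrow> c = 1))))"
    (is "_ \<and> (\<forall>B. ?T B \<longrightarrow> (\<exists>c. ?P B c))")
proof -
  interpret pineiro_system p q \<alpha> \<beta> n m
    by unfold_locales (use assms in blast)+
  have "\<exists>c. ?P B c"
    if B: "typeII_pineiro p q \<alpha> \<beta> n m B" for B
  proof -
    obtain c where c0: "c \<noteq> 0"
      and c: "\<And>s. s \<in> idx \<Longrightarrow> coeff (B (fst s)) (snd s) = c * weight s"
      using typeII_coeff[OF B] by blast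
    have deg: "\<forall>j\<in>{1..q}. if m j = 0 then B j = 0 else degree (B j) \<le> m j - 1"
      using B unfolding typeII_pineiro_def by blast
    have coeff: "coeff (B j) k = c * pineiro_coeff p q \<alpha> \<beta> n m j k"
      if "j \<in> {1..q}" "k < m j" for j k
      using c[of "(j, k)"] that by (simp add: idx_def weight_def)
    have form: "mixed_form q \<beta> B x = c * (\<Sum>s\<in>idx. weight s * x powr node s)" if "x > 0" for x
      using that c by (simp add: mixed_form_powers[OF deg] sum_distrib_left mult.assoc)
    show ?thesis
    proof (rule exI[of _ c], intro conjI ballI allI impI c0)
      fix j x assume j: "j \<in> {1..q}" "1 \<le> m j"
      have "degree (B j) < m j" using deg j by fastforce
      then have "poly (B j) x = (\<Sum>k<m j. coeff (B j) k * x ^ k)"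
        unfolding poly_altdef by (intro sum.mono_neutral_left) (auto simp: coeff_eq_0)
      also have "\<dots> = c * (\<Sum>k<m j. pineiro_coeff p q \<alpha> \<beta> n m j k * x ^ k)"
        using j by (simp add: coeff sum_distrib_left mult.assoc)
      finally show "poly (B j) x =
          c * ((\<Prod>i=1..p. pochhammer (\<alpha> i + \<beta> j + 1) (n i)) /
               (fact (m j - 1) * (\<Prod>i\<in>{1..q} - {j}. pochhammer (\<beta> i - \<beta> j) (m i))) *
               hypergeom
                 ([- real (m j) + 1] @
                  map (\<lambda>k. \<alpha> k + \<beta> j + real (n k) + 1) [1..<Suc p] @
                  map (\<lambda>k. \<beta> j - \<beta> k - real (m k) + 1) (filter (\<lambda>k. k \<noteq> j) [1..<Suc q]))
                 (map (\<lambda>k. \<alpha> k + \<beta> j + 1) [1..<Suc p] @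
                  map (\<lambda>k. \<beta> j - \<beta> k + 1) (filter (\<lambda>k. k \<noteq> j) [1..<Suc q]))
                 x)"
        using pineiro_hypergeom[of j q m p \<alpha> \<beta> n x] j sum_gt beta_nonint by auto
    next
      fix j k assume "j \<in> {1..q}" "1 \<le> m j" "k \<le> m j - 1"
      then show "coeff (B j) k =
          c * ((\<Prod>i=1..p. pochhammer (\<alpha> i + real k + \<beta> j + 1) (n i)) /
               ((\<Prod>i\<in>{1..q} - {j}. pochhammer (\<beta> i - \<beta> j - real k) (m i)) *
                fact k * fact (m j - k - 1) * (-1) ^ k))"
        using coeff[of j k] by (simp add: pineiro_coeff_def)
    next
      fix j assume j: "j \<in> {1..q}" "1 \<le> m j"
      \<comment> \<open>The nonzero weight shows that the degree bound is attained, so this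
        coefficient really is the leading one.\<close>
      have "coeff (B j) (m j - 1) \<noteq> 0"
        using c[of "(j, m j - 1)"] weight_nonzero[of "(j, m j - 1)"] c0 j by (simp add: idx_def)
      then have "m j - 1 \<le> degree (B j)"
        by (rule le_degree)
      then show "lead_coeff (B j) = coeff (B j) (m j - 1)"
        using deg j by fastforce
    next
      fix j assume j: "j \<in> {1..q}" "1 \<le> m j"
      \<comment> \<open>The case k = m j - 1, where k + 1 = m j and the factorial of m j - k - 1 is
        0! = 1.\<close>
      then show "coeff (B j) (m j - 1) =
          c * ((\<Prod>i=1..p. pochhammer (\<beta> j + real (m j) + \<alpha> i) (n i)) /
               ((\<Prod>i\<in>{1..q} - {j}. pochhammer (\<beta> i - \<beta> j - real (m j) + 1) (m i)) *
                fact (m j - 1) * (-1) ^ (m j - 1)))"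
        using coeff[of j "m j - 1"] by (simp add: pineiro_coeff_def of_nat_diff algebra_simps)
    next
      fix \<gamma> assume \<gamma>: "pineiro_contour q \<beta> m \<gamma>"
      show "(\<forall>x\<in>{0<..<1}. of_real (mixed_form q \<beta> B x) = contour_form p q \<alpha> \<beta> n m \<gamma> x)
          \<longleftrightarrow> c = 1"
      proof
        assume eq: "\<forall>x\<in>{0<..<1}. of_real (mixed_form q \<beta> B x) = contour_form p q \<alpha> \<beta> n m \<gamma> x"
        \<comment> \<open>At one point where the form is nonzero, F = c * F with F the weighted
          power sum already forces c = 1.\<close>
        obtain x where x: "x \<in> {0<..<1}" "mixed_form q \<beta> B x \<noteq> 0"
          using B unfolding typeII_pineiro_def by blast
        have "complex_of_real (mixed_form q \<beta> B x) =
            of_real (\<Sum>s\<in>idx. weight s * x powr node s)"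
          using eq x contour_form_eq[OF \<gamma>, of x] by (metis greaterThanLessThan_iff)
        then have "mixed_form q \<beta> B x = (\<Sum>s\<in>idx. weight s * x powr node s)"
          by (simp only: of_real_eq_iff)
        then show "c = 1"
          using x form[of x] by auto
      next
        assume "c = 1"
        then show "\<forall>x\<in>{0<..<1}. of_real (mixed_form q \<beta> B x) = contour_form p q \<alpha> \<beta> n m \<gamma> x"
          using form contour_form_eq[OF \<gamma>] by simp
      qed
    qed
  qed
  then show ?thesis
    using typeII_exists by blast
qed

end
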